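(* Consider the mixed integer quadratic program (MIQP): minimize $$\tfrac12\mathbf{x}_C^\top Q_{CC}\mathbf{x}_C+\tfrac12\mathbf{x}_I^\top Q_{II}\mathbf{x}_I+\mathbf{x}_I^\top Q_{IC}\mathbf{x}_C-\mathbf{c}_I^\top\mathbf{x}_I-\mathbf{c}_C^\top\mathbf{x}_C$$ subject to $\mathbf{A}_I\mathbf{x}_I+\mathbf{A}_C\mathbf{x}_C=\mathbf{b}$, $\mathbf{E}_I\mathbf{x}_I+\mathbf{E}_C\mathbf{x}_C\le\mathbf{f}$, $\|\mathbf{x}_I\|_\infty\le M$, $(\mathbf{x}_I,\mathbf{x}_C)\in\mathbb{Z}^{n_1}\times\mathbb{R}^{n_2}$, where $M<\infty$, $\mathbf{A}=[\mathbf{A}_I\ \mathbf{A}_C]$ and $\mathbf{E}=[\mathbf{E}_I\ \mathbf{E}_C]$ are rational full-rank matrices, $\mathbf{b},\mathbf{f},\mathbf{c}=(\mathbf{c}_I,\mathbf{c}_C)$ are rational vectors, and $\mathbf{Q}$ is a rational symmetric positive semidefinite matrix. Assume that both (MIQP) and its continuous relaxation are feasible and have optimal solutions, and let $z_{IP}$ be the optimal value of (MIQP). Then there exists an exact penalty representation for (MIQP) with augmenting function $\psi=\|\cdot\|$: there is a $\rho$ with $0<\rho<\infty$ and $z^{LD+}_\rho=z_{IP}$. Furthermore, the finite penalty parameter $\rho$ depends on $\mathbf{A},\mathbf{Q},\mathbf{c}$ and $M$.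
   Context: $\mathbf{A}$ has $m$ rows and $\|\cdot\|$ is the Euclidean norm. $Q_{UV}$ denotes the submatrix of $\mathbf{Q}$ with rows indexed by $U$ and columns indexed by $V$, where $I$ and $C$ index the integer and the continuous variables. Write $q(\mathbf{x})$ for the objective function and $X=\{\mathbf{x}=(\mathbf{x}_I,\mathbf{x}_C)\in\mathbb{Z}^{n_1}\times\mathbb{R}^{n_2}:\mathbf{E}\mathbf{x}\le\mathbf{f},\ \|\mathbf{x}_I\|_\infty\le M\}$. The continuous relaxation is obtained by replacing $\mathbb{Z}^{n_1}$ by $\mathbb{R}^{n_1}$. The augmented Lagrangian dual (dualizing $\mathbf{A}\mathbf{x}=\mathbf{b}$) with augmenting function $\psi=\|\cdot\|$ and penalty parameter $\rho>0$ is $$z^{LD+}_\rho=\sup_{\boldsymbol\lambda\in\mathbb{R}^m}\ \min_{\mathbf{x}\in X}\ q(\mathbf{x})+\boldsymbol\lambda^\top(\mathbf{b}-\mathbf{A}\mathbf{x})+\rho\|\mathbf{b}-\mathbf{A}\mathbf{x}\|,$$ where the inner minimum is read as an infimum if not attained.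
   Formalization: The penalty parameter is given as a function of A, Q, c and M for fixed b, E, f and fixed set of integer variables; a single ρ depending only on A, Q, c, M and valid for all b, E, f does not exist in general. *)

theory Defs
  imports "HOL-Analysis.Analysis"
begin

text \<open>Vectors are indexed by a single finite type; a set \<open>I\<close> of indices marks the integer
  variables and its complement \<open>- I\<close> the continuous ones.\<close>

definition rational_vec :: "real ^ 'n \<Rightarrow> bool" where
  "rational_vec v \<longleftrightarrow> (\<forall>i. v $ i \<in> \<rat>)"

definition rational_mat :: "real ^ 'n ^ 'm \<Rightarrow> bool" where
  "rational_mat A \<longleftrightarrow> (\<forall>i j. A $ i $ j \<in> \<rat>)"

definition full_rank :: "real ^ 'n ^ 'm \<Rightarrow> bool" where
  "full_rank A \<longleftrightarrow> rank A = min CARD('m) CARD('n)"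

definition sym_psd :: "real ^ 'n ^ 'n \<Rightarrow> bool" where
  "sym_psd Q \<longleftrightarrow> transpose Q = Q \<and> (\<forall>x. 0 \<le> x \<bullet> (Q *v x))"

text \<open>\<open>block_form Q U V x\<close> is $x_U^T Q_{UV} x_V$.\<close>

definition block_form :: "real ^ 'n ^ 'n \<Rightarrow> 'n set \<Rightarrow> 'n set \<Rightarrow> real ^ 'n \<Rightarrow> real" where
  "block_form Q U V x = (\<Sum>i\<in>U. \<Sum>j\<in>V. x $ i * Q $ i $ j * x $ j)"

definition miqp_obj :: "'n set \<Rightarrow> real ^ 'n ^ 'n \<Rightarrow> real ^ 'n \<Rightarrow> real ^ 'n \<Rightarrow> real" where
  "miqp_obj I Q c x =
     1/2 * block_form Q (- I) (- I) x + 1/2 * block_form Q I I x + block_form Q I (- I) x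
     - (\<Sum>i\<in>I. c $ i * x $ i) - (\<Sum>i\<in>- I. c $ i * x $ i)"

text \<open>The order on vectors is componentwise. The bound \<open>M\<close> on the integer-indexed components
  (the max-norm of $x_I$) is kept in the continuous relaxation.\<close>

definition relax_X :: "'n set \<Rightarrow> real ^ 'n ^ 'p \<Rightarrow> real ^ 'p \<Rightarrow> real \<Rightarrow> (real ^ 'n) set" where
  "relax_X I E f M = {x. E *v x \<le> f \<and> (\<forall>i\<in>I. \<bar>x $ i\<bar> \<le> M)}"

definition miqp_X :: "'n set \<Rightarrow> real ^ 'n ^ 'p \<Rightarrow> real ^ 'p \<Rightarrow> real \<Rightarrow> (real ^ 'n) set" where
  "miqp_X I E f M = {x \<in> relax_X I E f M. \<forall>i\<in>I. x $ i \<in> \<int>}"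

definition miqp_feasible ::
  "'n set \<Rightarrow> real ^ 'n ^ 'm \<Rightarrow> real ^ 'm \<Rightarrow> real ^ 'n ^ 'p \<Rightarrow> real ^ 'p \<Rightarrow> real \<Rightarrow> (real ^ 'n) set"
  where "miqp_feasible I A b E f M = {x \<in> miqp_X I E f M. A *v x = b}"

definition relax_feasible ::
  "'n set \<Rightarrow> real ^ 'n ^ 'm \<Rightarrow> real ^ 'm \<Rightarrow> real ^ 'n ^ 'p \<Rightarrow> real ^ 'p \<Rightarrow> real \<Rightarrow> (real ^ 'n) set"
  where "relax_feasible I A b E f M = {x \<in> relax_X I E f M. A *v x = b}"

definition has_optimal_solution :: "('a \<Rightarrow> real) \<Rightarrow> 'a set \<Rightarrow> bool" where
  "has_optimal_solution q S \<longleftrightarrow> (\<exists>x. is_arg_min q (\<lambda>x. x \<in> S) x)"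

text \<open>Optimal values are extended reals: for some multipliers the inner infimum of the
  augmented Lagrangian dual can be \<open>-\<infinity>\<close>.\<close>

definition opt_value :: "('a \<Rightarrow> real) \<Rightarrow> 'a set \<Rightarrow> ereal" where
  "opt_value q S = (INF x\<in>S. ereal (q x))"

definition z_IP ::
  "'n set \<Rightarrow> real ^ 'n ^ 'm \<Rightarrow> real ^ 'm \<Rightarrow> real ^ 'n ^ 'p \<Rightarrow> real ^ 'p \<Rightarrow>
   real ^ 'n ^ 'n \<Rightarrow> real ^ 'n \<Rightarrow> real \<Rightarrow> ereal"
  where "z_IP I A b E f Q c M = opt_value (miqp_obj I Q c) (miqp_feasible I A b E f M)"

definition z_LDplus ::
  "'n set \<Rightarrow> real ^ 'n ^ 'm \<Rightarrow> real ^ 'm \<Rightarrow> real ^ 'n ^ 'p \<Rightarrow> real ^ 'p \<Rightarrow>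
   real ^ 'n ^ 'n \<Rightarrow> real ^ 'n \<Rightarrow> real \<Rightarrow> (real ^ 'm \<Rightarrow> real) \<Rightarrow> real \<Rightarrow> ereal"
  where "z_LDplus I A b E f Q c M \<psi> \<rho> =
    (SUP l. opt_value
       (\<lambda>x. miqp_obj I Q c x + l \<bullet> (b - A *v x) + \<rho> * \<psi> (b - A *v x)) (miqp_X I E f M))"

end

theory Submission
  imports Defs
begin

text \<open>Already the multiplier \<open>0\<close> attains the dual bound. A convex function that is at least \<open>z\<close> on a
  nonempty polyhedron cut by \<open>A x = b\<close> admits Lagrange multipliers, so it is at least
  \<open>z - \<rho> \<parallel>b - A x\<parallel>\<close> on the whole polyhedron. This is applied to each of the finitely many slices
  of the feasible region with fixed integer part. If a slice misses \<open>A x = b\<close>, the same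
  multiplier result for the zero function (a Farkas certificate) bounds \<open>\<parallel>b - A x\<parallel>\<close> away from 0,
  and the penalty bound of the continuous relaxation, with its weaker optimal value, can be
  raised to the integer value by a larger penalty.\<close>

section \<open>Multipliers for affine equality and inequality constraints\<close>

lemma affine_inner_diff:
  fixes a :: "'a::real_inner"
  assumes "u + v = 1"
  shows "a \<bullet> (u *\<^sub>R x + v *\<^sub>R y) - \<beta> = u * (a \<bullet> x - \<beta>) + v * (a \<bullet> y - \<beta>)"
proof -
  have "\<beta> = (u + v) * \<beta>" using assms by simp
  then show ?thesis by (simp add: inner_add_right algebra_simps)
qed

lemma convex_on_add_affine:
  fixes a :: "'a::real_inner"
  assumes "convex_on UNIV q"
  shows "convex_on UNIV (\<lambda>x. q x + w * (a \<bullet> x - \<beta>))"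
proof (rule convex_onI)
  fix t :: real and x y :: 'a
  assume t: "0 < t" "t < 1"
  have "q ((1 - t) *\<^sub>R x + t *\<^sub>R y) \<le> (1 - t) * q x + t * q y"
    using convex_onD[OF assms, of t x y] t by simp
  then show "q ((1 - t) *\<^sub>R x + t *\<^sub>R y) + w * (a \<bullet> ((1 - t) *\<^sub>R x + t *\<^sub>R y) - \<beta>)
      \<le> (1 - t) * (q x + w * (a \<bullet> x - \<beta>)) + t * (q y + w * (a \<bullet> y - \<beta>))"
    by (simp add: affine_inner_diff algebra_simps)
qed simp

text \<open>Each endpoint is weighted by the size of the other's residual, so residuals of opposite
  sign cancel. This moves a point satisfying an inequality towards a violating one until the
  inequality is tight.\<close>

lemma segment_zero:
  fixes a :: "'a::real_inner"
  assumes "(a \<bullet> x - \<beta>) * (a \<bullet> y - \<beta>) \<le> 0" "a \<bullet> x \<noteq> a \<bullet> y"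
  obtains u v where "u \<ge> 0" "v \<ge> 0" "u + v = 1" "a \<bullet> (u *\<^sub>R x + v *\<^sub>R y) = \<beta>"
proof -
  define s t where "s = a \<bullet> x - \<beta>" and "t = a \<bullet> y - \<beta>"
  have ne: "\<bar>s\<bar> + \<bar>t\<bar> > 0" using assms(2) by (auto simp: s_def t_def)
  define u v where "u = \<bar>t\<bar> / (\<bar>s\<bar> + \<bar>t\<bar>)" and "v = \<bar>s\<bar> / (\<bar>s\<bar> + \<bar>t\<bar>)"
  have uv: "u \<ge> 0" "v \<ge> 0" using ne by (auto simp: u_def v_def)
  have sum: "u + v = 1" using ne unfolding u_def v_def by (simp flip: add_divide_distrib)
  have "\<bar>t\<bar> * s + \<bar>s\<bar> * t = 0"
    using assms(1) unfolding s_def[symmetric] t_def[symmetric]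
    by (auto simp: mult_le_0_iff abs_if)
  then have "u * s + v * t = 0"
    unfolding u_def v_def by (simp flip: add_divide_distrib)
  then have "a \<bullet> (u *\<^sub>R x + v *\<^sub>R y) - \<beta> = 0"
    using affine_inner_diff[OF sum, of a x y \<beta>] by (simp add: s_def t_def)
  then show ?thesis using that uv sum by simp
qed

text \<open>Points of \<open>L\<close> with \<open>a \<bullet> x > \<beta>\<close> bound
  \<open>\<nu>\<close> from below, those with \<open>a \<bullet> x < \<beta>\<close> from above.
  Convexity along a segment crossing the hyperplane puts every lower bound below every upper one.
  The second alternative of \<open>feas\<close> serves an \<open>L\<close> that misses the
  hyperplane.\<close>

lemma equality_multiplier:
  fixes a :: "'a::real_inner"
  assumes L: "affine L" and q: "convex_on UNIV q"
    and bound: "\<And>x. x \<in> L \<Longrightarrow> a \<bullet> x = \<beta> \<Longrightarrow> z \<le> q x"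
    and feas: "(\<exists>x\<in>L. a \<bullet> x = \<beta>) \<or> (\<exists>B. \<forall>x. B \<le> q x)"
  shows "\<exists>\<nu>. \<forall>x\<in>L. z \<le> q x + \<nu> * (a \<bullet> x - \<beta>)"
proof (cases "\<exists>x0\<in>L. a \<bullet> x0 = \<beta>")
  case False
  then obtain B where B: "\<And>x. B \<le> q x" using feas by auto
  show ?thesis
  proof (cases "L = {}")
    case True
    then show ?thesis by auto
  next
    case ne: False
    then obtain x1 where x1: "x1 \<in> L" by auto
    define s where "s = a \<bullet> x1 - \<beta>"
    have s: "s \<noteq> 0" using False x1 by (auto simp: s_def)
    \<comment> \<open>A second residual would make the line through \<open>x1\<close> and
      \<open>x\<close> meet the hyperplane. One of the weights may be negative, so this uses that
      \<open>L\<close> is affine, not merely convex.\<close>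
    have const: "a \<bullet> x - \<beta> = s" if x: "x \<in> L" for x
    proof (rule ccontr)
      define t where "t = a \<bullet> x - \<beta>"
      assume "a \<bullet> x - \<beta> \<noteq> s"
      then have st: "t - s \<noteq> 0" by (simp add: t_def)
      define u v where "u = t / (t - s)" and "v = - s / (t - s)"
      have uv: "u + v = 1" using st by (simp add: u_def v_def flip: diff_divide_distrib)
      have "a \<bullet> (u *\<^sub>R x1 + v *\<^sub>R x) - \<beta> = u * s + v * t"
        unfolding affine_inner_diff[OF uv] by (simp add: s_def t_def)
      also have "\<dots> = 0" by (simp add: u_def v_def)
      finally show False using False L x1 x uv unfolding affine_def by auto
    qed
    \<comment> \<open>On \<open>L\<close> the added term is the constant \<open>z - B\<close>, which
      lifts the global bound \<open>B\<close> to \<open>z\<close>.\<close>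
    have "z \<le> q x + (z - B) / s * (a \<bullet> x - \<beta>)" if "x \<in> L" for x
      using B[of x] s const[OF that] by simp
    then show ?thesis by blast
  qed
next
  case True
  then obtain x0 where x0: "x0 \<in> L" "a \<bullet> x0 = \<beta>" by auto
  show ?thesis
  proof (cases "\<forall>x\<in>L. a \<bullet> x = \<beta>")
    case True
    then show ?thesis using bound by auto
  next
    case False
    then obtain x1 where x1: "x1 \<in> L" "a \<bullet> x1 \<noteq> \<beta>" by auto
    \<comment> \<open>The reflection of \<open>x1\<close> in \<open>x0\<close>: \<open>L\<close> now
      has points strictly on both sides, which will make \<open>S\<close> nonempty and bounded
      above.\<close>
    define x2 where "x2 = 2 *\<^sub>R x0 + (-1) *\<^sub>R x1"
    have x2: "x2 \<in> L" unfolding x2_def by (rule mem_affine[OF L x0(1) x1(1)]) simp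
    have ax2: "a \<bullet> x2 - \<beta> = - (a \<bullet> x1 - \<beta>)"
      using x0 by (simp add: x2_def inner_diff_right)
    have neg: "\<exists>y\<in>L. a \<bullet> y < \<beta>" and pos: "\<exists>x\<in>L. a \<bullet> x > \<beta>"
      using x1 x2 ax2 by (cases "a \<bullet> x1 < \<beta>"; force)+
    \<comment> \<open>The lower bounds on the multiplier; their supremum will be the
      multiplier.\<close>
    define S where "S = (\<lambda>x. (z - q x) / (a \<bullet> x - \<beta>)) ` {x \<in> L. a \<bullet> x > \<beta>}"
    have le: "r \<le> (q y - z) / (\<beta> - a \<bullet> y)" if "r \<in> S" "y \<in> L" "a \<bullet> y < \<beta>" for r y
    proof -
      obtain x where x: "x \<in> L" "a \<bullet> x > \<beta>" and r: "r = (z - q x) / (a \<bullet> x - \<beta>)"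
        using \<open>r \<in> S\<close> unfolding S_def by blast
      define s t where "s = a \<bullet> x - \<beta>" and "t = \<beta> - a \<bullet> y"
      have st: "s > 0" "t > 0" using x that by (auto simp: s_def t_def)
      define u v where "u = t / (s + t)" and "v = s / (s + t)"
      have uv: "u \<ge> 0" "v \<ge> 0" "u + v = 1"
        using st by (auto simp: u_def v_def simp flip: add_divide_distrib)
      have "a \<bullet> (u *\<^sub>R x + v *\<^sub>R y) - \<beta> = u * s - v * t"
        unfolding affine_inner_diff[OF uv(3)] by (simp add: s_def t_def algebra_simps)
      also have "\<dots> = 0" by (simp add: u_def v_def)
      finally have "z \<le> q (u *\<^sub>R x + v *\<^sub>R y)"
        using L x(1) that(2) uv unfolding affine_def by (intro bound) auto
      also have "\<dots> \<le> u * q x + v * q y"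
        using q uv unfolding convex_on_def by auto
      also have "\<dots> = (t * q x + s * q y) / (s + t)"
        by (simp add: u_def v_def add_divide_distrib)
      finally have "z * (s + t) \<le> t * q x + s * q y" using st by (simp add: field_simps)
      then have "(z - q x) / s \<le> (q y - z) / t" using st by (simp add: field_simps)
      then show ?thesis by (simp add: r s_def t_def)
    qed
    have S: "S \<noteq> {}" "bdd_above S" using pos neg le by (auto simp: S_def bdd_above_def)
    have "z \<le> q x + Sup S * (a \<bullet> x - \<beta>)" if x: "x \<in> L" for x
    proof (cases "a \<bullet> x" \<beta> rule: linorder_cases)
      case less
      have "Sup S \<le> (q x - z) / (\<beta> - a \<bullet> x)"
        using cSup_least[OF S(1)] le x less by blast
      then show ?thesis using less by (simp add: field_simps)
    next
      case equal
      then show ?thesis using bound x by simp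
    next
      case greater
      have "(z - q x) / (a \<bullet> x - \<beta>) \<le> Sup S"
        using S(2) greater x by (intro cSup_upper) (auto simp: S_def)
      then show ?thesis using greater by (simp add: field_simps)
    qed
    then show ?thesis by blast
  qed
qed

lemma affine_equality_system:
  fixes a :: "'i \<Rightarrow> 'a::real_inner"
  shows "affine {x. \<forall>i\<in>J. a i \<bullet> x = \<beta> i}"
  unfolding affine_def by (auto simp: inner_add_right) (metis distrib_right mult_1)

text \<open>The multiplier term of the inserted equation is absorbed into the objective, which stays
  convex; hence the induction generalizes over \<open>q\<close>.\<close>

lemma equality_multipliers:
  fixes a :: "'i \<Rightarrow> 'a::real_inner"
  assumes "finite J" and "convex_on UNIV q"
    and "\<And>x. \<forall>i\<in>J. a i \<bullet> x = \<beta> i \<Longrightarrow> z \<le> q x"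
    and "(\<exists>x. \<forall>i\<in>J. a i \<bullet> x = \<beta> i) \<or> (\<exists>B. \<forall>x. B \<le> q x)"
  shows "\<exists>w. \<forall>x. z \<le> q x + (\<Sum>i\<in>J. w i * (a i \<bullet> x - \<beta> i))"
  using assms
proof (induction J arbitrary: q rule: finite_induct)
  case empty
  then show ?case by auto
next
  case (insert j J)
  let ?L = "{x. \<forall>i\<in>J. a i \<bullet> x = \<beta> i}"
  \<comment> \<open>If the remaining equations are inconsistent, only the global bound on
    \<open>q\<close> is at hand, and a nonzero affine term could destroy it. Taking
    \<open>\<nu> = 0\<close> preserves it for the induction hypothesis.\<close>
  have "\<exists>\<nu>. (\<forall>x\<in>?L. z \<le> q x + \<nu> * (a j \<bullet> x - \<beta> j)) \<and> (?L = {} \<longrightarrow> \<nu> = 0)"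
  proof (cases "?L = {}")
    case False
    have "\<exists>\<nu>. \<forall>x\<in>?L. z \<le> q x + \<nu> * (a j \<bullet> x - \<beta> j)"
      using insert.prems by (intro equality_multiplier affine_equality_system) auto
    then show ?thesis using False by auto
  qed auto
  then obtain \<nu> where \<nu>: "\<And>x. x \<in> ?L \<Longrightarrow> z \<le> q x + \<nu> * (a j \<bullet> x - \<beta> j)"
    and \<nu>0: "?L = {} \<Longrightarrow> \<nu> = 0" by blast
  have "\<exists>w. \<forall>x. z \<le> (q x + \<nu> * (a j \<bullet> x - \<beta> j)) + (\<Sum>i\<in>J. w i * (a i \<bullet> x - \<beta> i))"
  proof (rule insert.IH)
    show "convex_on UNIV (\<lambda>x. q x + \<nu> * (a j \<bullet> x - \<beta> j))"
      by (rule convex_on_add_affine) fact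
    show "(\<exists>x. \<forall>i\<in>J. a i \<bullet> x = \<beta> i) \<or> (\<exists>B. \<forall>x. B \<le> q x + \<nu> * (a j \<bullet> x - \<beta> j))"
      using insert.prems(3) \<nu>0 by (cases "?L = {}") auto
  qed (use \<nu> in auto)
  then obtain w where w: "\<And>x. z \<le> (q x + \<nu> * (a j \<bullet> x - \<beta> j)) + (\<Sum>i\<in>J. w i * (a i \<bullet> x - \<beta> i))"
    by blast
  have "(\<Sum>i\<in>J. (w(j := \<nu>)) i * (a i \<bullet> x - \<beta> i)) = (\<Sum>i\<in>J. w i * (a i \<bullet> x - \<beta> i))" for x
    using insert.hyps by (intro sum.cong) auto
  then have "z \<le> q x + (\<Sum>i\<in>insert j J. (w(j := \<nu>)) i * (a i \<bullet> x - \<beta> i))" for x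
    using w[of x] insert.hyps by (simp add: algebra_simps)
  then show ?case by blast
qed

text \<open>Induction on the inequalities: if dropping \<open>k\<close> loses the bound \<open>z\<close>, make \<open>k\<close> an equality
  instead; a point violating the bound then forces the sign of its multiplier. Affine constraints
  need no Slater point, and a globally bounded \<open>q\<close> not even feasibility.\<close>

lemma lagrange_multipliers:
  fixes a :: "'i \<Rightarrow> 'a::real_inner"
  assumes "finite K" and "finite J" and "J \<inter> K = {}" and "convex_on UNIV q"
    and "\<And>x. \<forall>i\<in>J. a i \<bullet> x = \<beta> i \<Longrightarrow> \<forall>i\<in>K. a i \<bullet> x \<le> \<beta> i \<Longrightarrow> z \<le> q x"
    and "(\<exists>x. (\<forall>i\<in>J. a i \<bullet> x = \<beta> i) \<and> (\<forall>i\<in>K. a i \<bullet> x \<le> \<beta> i)) \<or> (\<exists>B. \<forall>x. B \<le> q x)"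
  shows "\<exists>w. (\<forall>i\<in>K. 0 \<le> w i) \<and> (\<forall>x. z \<le> q x + (\<Sum>i\<in>J \<union> K. w i * (a i \<bullet> x - \<beta> i)))"
  using assms
proof (induction K arbitrary: J rule: finite_induct)
  case empty
  then show ?case using equality_multipliers[of J q a \<beta> z] by auto
next
  case (insert k K)
  let ?F = "\<lambda>J K x. (\<forall>i\<in>J. a i \<bullet> x = \<beta> i) \<and> (\<forall>i\<in>K. a i \<bullet> x \<le> \<beta> i)"
  show ?case
  proof (cases "\<forall>x. ?F J K x \<longrightarrow> z \<le> q x")
    case True
    have "\<exists>w. (\<forall>i\<in>K. 0 \<le> w i) \<and> (\<forall>x. z \<le> q x + (\<Sum>i\<in>J \<union> K. w i * (a i \<bullet> x - \<beta> i)))"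
      using insert.prems True by (intro insert.IH) auto
    then obtain w where w: "\<And>i. i \<in> K \<Longrightarrow> 0 \<le> w i"
      "\<And>x. z \<le> q x + (\<Sum>i\<in>J \<union> K. w i * (a i \<bullet> x - \<beta> i))" by blast
    have k: "k \<notin> J \<union> K" using insert by auto
    have "(\<Sum>i\<in>J \<union> insert k K. (w(k := 0)) i * (a i \<bullet> x - \<beta> i)) =
        (\<Sum>i\<in>J \<union> K. (w(k := 0)) i * (a i \<bullet> x - \<beta> i))" for x
      using k insert.hyps insert.prems(1) by simp
    also have "\<dots> x = (\<Sum>i\<in>J \<union> K. w i * (a i \<bullet> x - \<beta> i))" for x
      using k by (intro sum.cong) auto
    finally show ?thesis using w by (intro exI[of _ "w(k := 0)"]) auto
  next
    case False
    then obtain y where y: "?F J K y" "q y < z" by (auto simp: not_le)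
    have ky: "a k \<bullet> y > \<beta> k"
      using insert.prems(4)[of y] y by (force simp: not_le[symmetric])
    \<comment> \<open>The induction hypothesis wants a point where \<open>k\<close> is tight. The
      segment from a feasible \<open>x\<close> to \<open>y\<close> contains one, and the other
      constraints hold at both ends, hence all along it.\<close>
    have feas: "(\<exists>x. ?F (insert k J) K x) \<or> (\<exists>B. \<forall>x. B \<le> q x)"
    proof (cases "\<exists>x. ?F J (insert k K) x")
      case True
      then obtain x where x: "?F J (insert k K) x" by blast
      have "(a k \<bullet> x - \<beta> k) * (a k \<bullet> y - \<beta> k) \<le> 0" using x ky by (intro mult_nonpos_nonneg) auto
      moreover have "a k \<bullet> x \<noteq> a k \<bullet> y" using x ky by auto
      ultimately obtain u v where uv: "u \<ge> 0" "v \<ge> 0" "u + v = 1"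
        "a k \<bullet> (u *\<^sub>R x + v *\<^sub>R y) = \<beta> k" by (rule segment_zero)
      have "a i \<bullet> (u *\<^sub>R x + v *\<^sub>R y) - \<beta> i = 0" if "i \<in> J" for i
        unfolding affine_inner_diff[OF uv(3)] using x y that by auto
      moreover have "a i \<bullet> (u *\<^sub>R x + v *\<^sub>R y) - \<beta> i \<le> 0" if "i \<in> K" for i
        unfolding affine_inner_diff[OF uv(3)] using x y that uv
        by (intro add_nonpos_nonpos mult_nonneg_nonpos) auto
      ultimately have "?F (insert k J) K (u *\<^sub>R x + v *\<^sub>R y)" using uv(4) by force
      then show ?thesis by blast
    qed (use insert.prems(5) in blast)
    have "\<exists>w. (\<forall>i\<in>K. 0 \<le> w i) \<and>
        (\<forall>x. z \<le> q x + (\<Sum>i\<in>insert k J \<union> K. w i * (a i \<bullet> x - \<beta> i)))"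
      using insert.prems insert.hyps feas by (intro insert.IH) auto
    then obtain w where w: "\<And>i. i \<in> K \<Longrightarrow> 0 \<le> w i"
      "\<And>x. z \<le> q x + (\<Sum>i\<in>insert k J \<union> K. w i * (a i \<bullet> x - \<beta> i))" by blast
    have k: "k \<notin> J \<union> K" using insert by auto
    have "(\<Sum>i\<in>J \<union> K. w i * (a i \<bullet> y - \<beta> i)) \<le> 0"
      using y w(1) by (intro sum_nonpos) (auto intro: mult_nonneg_nonpos)
    moreover have "z \<le> q y + (w k * (a k \<bullet> y - \<beta> k) + (\<Sum>i\<in>J \<union> K. w i * (a i \<bullet> y - \<beta> i)))"
      using w(2)[of y] k insert.hyps insert.prems(1) by simp
    ultimately have "w k * (a k \<bullet> y - \<beta> k) > 0" using y(2) by linarith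
    then have "w k > 0" using ky by (simp add: zero_less_mult_iff)
    then show ?thesis using w by (intro exI[of _ w]) auto
  qed
qed

section \<open>Exact penalty on a polyhedron\<close>

lemma polyhedron_exact_penalty:
  fixes A :: "real ^ 'n ^ 'm"
  assumes q: "convex_on UNIV q" and "polyhedron P"
    and bound: "\<And>x. x \<in> P \<Longrightarrow> A *v x = b \<Longrightarrow> z \<le> q x"
    and feas: "(\<exists>x\<in>P. A *v x = b) \<or> (\<exists>B. \<forall>x. B \<le> q x)"
  shows "\<exists>\<rho>\<ge>0. \<forall>x\<in>P. z \<le> q x + \<rho> * norm (b - A *v x)"
proof -
  obtain F :: "(real ^ 'n) set set" where F: "finite F" "P = \<Inter>F"
    "\<forall>H\<in>F. \<exists>a \<beta>. a \<noteq> 0 \<and> H = {x. a \<bullet> x \<le> \<beta>}"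
    using \<open>polyhedron P\<close> unfolding polyhedron_def by blast
  then obtain g \<gamma> where g: "\<And>H. H \<in> F \<Longrightarrow> H = {x. g H \<bullet> x \<le> \<gamma> H}" by metis
  have P: "x \<in> P \<longleftrightarrow> (\<forall>H\<in>F. g H \<bullet> x \<le> \<gamma> H)" for x using F(2) g by auto
  \<comment> \<open>The sum type puts the rows of \<open>A\<close> and the halfspaces of
    \<open>P\<close> into one index type, with disjoint index sets.\<close>
  define J :: "('m + (real ^ 'n) set) set" where "J = range Inl"
  define K :: "('m + (real ^ 'n) set) set" where "K = Inr ` F"
  define a where "a = case_sum (\<lambda>j. A $ j) g"
  define \<beta> where "\<beta> = case_sum (($) b) \<gamma>"
  have J: "(\<forall>i\<in>J. a i \<bullet> x = \<beta> i) \<longleftrightarrow> A *v x = b" for x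
    by (simp add: J_def a_def \<beta>_def vec_eq_iff matrix_vector_mul_component)
  have K: "(\<forall>i\<in>K. a i \<bullet> x \<le> \<beta> i) \<longleftrightarrow> x \<in> P" for x
    by (simp add: K_def a_def \<beta>_def P)
  have fin: "finite J" "finite K" "J \<inter> K = {}" using F(1) by (auto simp: J_def K_def)
  have "\<exists>w. (\<forall>i\<in>K. 0 \<le> w i) \<and> (\<forall>x. z \<le> q x + (\<Sum>i\<in>J \<union> K. w i * (a i \<bullet> x - \<beta> i)))"
    using fin q bound feas by (intro lagrange_multipliers) (auto simp: J K)
  then obtain w where w: "\<And>i. i \<in> K \<Longrightarrow> 0 \<le> w i"
    "\<And>x. z \<le> q x + (\<Sum>i\<in>J \<union> K. w i * (a i \<bullet> x - \<beta> i))" by blast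
  define \<rho> where "\<rho> = (\<Sum>j\<in>UNIV. \<bar>w (Inl j)\<bar>)"
  have "z \<le> q x + \<rho> * norm (b - A *v x)" if "x \<in> P" for x
  proof -
    have "(\<Sum>i\<in>J. w i * (a i \<bullet> x - \<beta> i)) = (\<Sum>j\<in>UNIV. w (Inl j) * ((A *v x) $ j - b $ j))"
      by (simp add: J_def a_def \<beta>_def sum.reindex matrix_vector_mul_component)
    also have "\<dots> \<le> (\<Sum>j\<in>UNIV. \<bar>w (Inl j)\<bar> * norm (b - A *v x))"
    proof (rule sum_mono)
      fix j
      have "\<bar>(A *v x) $ j - b $ j\<bar> \<le> norm (b - A *v x)"
        using component_le_norm_cart[of "b - A *v x" j] by (simp add: abs_minus_commute)
      then have "\<bar>w (Inl j)\<bar> * \<bar>(A *v x) $ j - b $ j\<bar> \<le> \<bar>w (Inl j)\<bar> * norm (b - A *v x)"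
        by (intro mult_left_mono) auto
      then show "w (Inl j) * ((A *v x) $ j - b $ j) \<le> \<bar>w (Inl j)\<bar> * norm (b - A *v x)"
        using abs_ge_self[of "w (Inl j) * ((A *v x) $ j - b $ j)"] unfolding abs_mult by linarith
    qed
    finally have "(\<Sum>i\<in>J. w i * (a i \<bullet> x - \<beta> i)) \<le> \<rho> * norm (b - A *v x)"
      by (simp add: \<rho>_def sum_distrib_right)
    moreover have "(\<Sum>i\<in>K. w i * (a i \<bullet> x - \<beta> i)) \<le> 0"
      using K[of x] that w(1) by (intro sum_nonpos) (auto intro: mult_nonneg_nonpos)
    ultimately show ?thesis using w(2)[of x] fin by (simp add: sum.union_disjoint)
  qed
  moreover have "\<rho> \<ge> 0" by (simp add: \<rho>_def sum_nonneg)
  ultimately show ?thesis by blast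
qed

section \<open>The quadratic objective\<close>

text \<open>By symmetry the two off-diagonal blocks contribute equally, which accounts for the
  missing factor 1/2 on the mixed term.\<close>

lemma miqp_obj_eq:
  assumes "transpose Q = Q"
  shows "miqp_obj I Q c x = 1/2 * (x \<bullet> (Q *v x)) - c \<bullet> x"
proof -
  let ?t = "\<lambda>i j. x $ i * Q $ i $ j * x $ j"
  have Q: "Q $ i $ j = Q $ j $ i" for i j
    using assms by (metis transpose_def vec_lambda_beta)
  have split: "sum h UNIV = sum h I + sum h (- I)" for h :: "'a \<Rightarrow> real"
    using sum.union_disjoint[of I "- I" h] by (simp add: Compl_partition)
  have "x \<bullet> (Q *v x) = (\<Sum>i\<in>UNIV. \<Sum>j\<in>UNIV. ?t i j)"
    by (simp add: inner_vec_def matrix_vector_mult_def sum_distrib_left mult.assoc)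
  also have "\<dots> = block_form Q I I x + block_form Q I (- I) x
      + (block_form Q (- I) I x + block_form Q (- I) (- I) x)"
    by (simp add: block_form_def split sum.distrib)
  also have "block_form Q (- I) I x = block_form Q I (- I) x"
    unfolding block_form_def by (subst sum.swap) (simp add: Q mult_ac)
  finally have "x \<bullet> (Q *v x) = block_form Q I I x + block_form Q (- I) (- I) x
      + 2 * block_form Q I (- I) x" by simp
  moreover have "c \<bullet> x = (\<Sum>i\<in>I. c $ i * x $ i) + (\<Sum>i\<in>- I. c $ i * x $ i)"
    by (simp add: inner_vec_def split)
  ultimately show ?thesis by (simp add: miqp_obj_def)
qed

text \<open>The gap in the convexity inequality is exactly \<open>t * (1 - t) / 2\<close> times the
  quadratic form at \<open>x - y\<close>; the linear part cancels.\<close>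

lemma convex_on_miqp_obj:
  assumes "sym_psd Q"
  shows "convex_on UNIV (miqp_obj I Q c)"
proof (rule convex_onI)
  fix t :: real and x y :: "real ^ 'a"
  assume t: "0 < t" "t < 1"
  have sym: "transpose Q = Q" and psd: "0 \<le> v \<bullet> (Q *v v)" for v
    using assms by (auto simp: sym_psd_def)
  have comm: "y \<bullet> (Q *v x) = x \<bullet> (Q *v y)"
    by (metis sym dot_lmul_matrix inner_commute transpose_matrix_vector)
  have "0 \<le> t * (1 - t) / 2 * ((x - y) \<bullet> (Q *v (x - y)))"
    using t psd by (intro mult_nonneg_nonneg) auto
  also have "\<dots> = (1 - t) * miqp_obj I Q c x + t * miqp_obj I Q c y
      - miqp_obj I Q c ((1 - t) *\<^sub>R x + t *\<^sub>R y)"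
    unfolding miqp_obj_eq[OF sym] matrix_vector_mult_diff_distrib matrix_vector_right_distrib
      matrix_vector_mult_scaleR inner_add_left inner_add_right inner_diff_left inner_diff_right
      inner_scaleR_left inner_scaleR_right comm
    by (simp add: field_simps)
  finally show "miqp_obj I Q c ((1 - t) *\<^sub>R x + t *\<^sub>R y)
      \<le> (1 - t) * miqp_obj I Q c x + t * miqp_obj I Q c y" by simp
qed simp

section \<open>Polyhedral slices and their finite number\<close>

lemma polyhedron_matrix_le:
  fixes E :: "real ^ 'n ^ 'p"
  shows "polyhedron {x. E *v x \<le> f}"
proof -
  have "{x. E *v x \<le> f} = (\<Inter>j. {x. E $ j \<bullet> x \<le> f $ j})"
    by (auto simp: less_eq_vec_def matrix_vector_mul_component)
  then show ?thesis by (auto simp: polyhedron_halfspace_le)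
qed

lemma polyhedron_relax_X: "polyhedron (relax_X I E f M)"
proof -
  have "relax_X I E f M = {x. E *v x \<le> f} \<inter>
      (\<Inter>i\<in>I. {x. axis i 1 \<bullet> x \<le> M} \<inter> {x. axis i 1 \<bullet> x \<ge> - M})"
    by (force simp: relax_X_def inner_axis' abs_le_iff)
  then show ?thesis
    by (auto intro!: polyhedron_Int polyhedron_Inter polyhedron_matrix_le
        polyhedron_halfspace_le polyhedron_halfspace_ge)
qed

lemma polyhedron_fiber:
  fixes k :: "real ^ 'n"
  shows "polyhedron {x. E *v x \<le> f \<and> (\<forall>i\<in>I. x $ i = k $ i)}"
proof -
  have "{x. E *v x \<le> f \<and> (\<forall>i\<in>I. x $ i = k $ i)} =
      {x. E *v x \<le> f} \<inter> (\<Inter>i\<in>I. {x. axis i 1 \<bullet> x = k $ i})"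
    by (auto simp: inner_axis')
  then show ?thesis
    by (auto intro!: polyhedron_Int polyhedron_Inter polyhedron_matrix_le polyhedron_hyperplane)
qed

text \<open>Coordinates outside \<open>I\<close> will be filled with 0. Inserting 0 keeps that value
  available when \<open>M\<close> is negative.\<close>

lemma finite_integer_parts:
  "finite {k :: real ^ 'n. \<forall>i. k $ i \<in> insert 0 {r \<in> \<int>. \<bar>r\<bar> \<le> M}}"
proof -
  let ?S = "insert 0 {r \<in> \<int>. \<bar>r\<bar> \<le> M} :: real set"
  have "finite (UNIV \<rightarrow>\<^sub>E ?S :: ('n \<Rightarrow> real) set)"
    by (intro finite_PiE) (auto simp: finite_abs_int_segment)
  moreover have "{k :: real ^ 'n. \<forall>i. k $ i \<in> ?S} \<subseteq> vec_lambda ` (UNIV \<rightarrow>\<^sub>E ?S)"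
    by (auto intro!: image_eqI[where x = "($) _"])
  ultimately show ?thesis by (meson finite_imageI finite_subset)
qed

section \<open>Combining the slices\<close>

text \<open>The bound \<open>z0\<close> serves the slices without feasible points. Such a slice can
  be unbounded and \<open>q\<close> unbounded below on it, so a positive distance to
  \<open>A *v x = b\<close> is not enough: \<open>q\<close> must also fall at most linearly in the
  residual, which the relaxation supplies.\<close>

lemma miqp_exact_penalty:
  fixes A :: "real ^ 'n ^ 'm"
  assumes q: "convex_on UNIV q"
    and relax: "\<And>x. x \<in> relax_feasible I A b E f M \<Longrightarrow> z0 \<le> q x"
    and relax_ne: "relax_feasible I A b E f M \<noteq> {}"
    and int: "\<And>x. x \<in> miqp_feasible I A b E f M \<Longrightarrow> z \<le> q x"
  shows "\<exists>\<rho>>0. \<forall>x\<in>miqp_X I E f M. z \<le> q x + \<rho> * norm (b - A *v x)"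
proof -
  define fiber where "fiber k = {x. E *v x \<le> f \<and> (\<forall>i\<in>I. x $ i = k $ i)}" for k :: "real ^ 'n"
  define N where "N = {k :: real ^ 'n. \<forall>i. k $ i \<in> insert 0 {r \<in> \<int>. \<bar>r\<bar> \<le> M}}"
  let ?d = "\<lambda>x. norm (b - A *v x)"
  obtain \<rho>0 where \<rho>0: "\<And>x. x \<in> relax_X I E f M \<Longrightarrow> z0 \<le> q x + \<rho>0 * ?d x"
    using polyhedron_exact_penalty[OF q polyhedron_relax_X, where A = A and b = b and z = z0] relax relax_ne
    unfolding relax_feasible_def by blast
  \<comment> \<open>Integrality and the bound \<open>M\<close> concern only the coordinates fixed by
    the slice, so one point having them gives them to the whole slice.\<close>
  have fiber_sub: "fiber k \<subseteq> miqp_X I E f M" if "y \<in> fiber k" "y \<in> miqp_X I E f M" for k y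
  proof
    fix x
    assume x: "x \<in> fiber k"
    have "x $ i = y $ i" if "i \<in> I" for i
      using x \<open>y \<in> fiber k\<close> that unfolding fiber_def by simp
    then show "x \<in> miqp_X I E f M"
      using x \<open>y \<in> miqp_X I E f M\<close> unfolding fiber_def miqp_X_def relax_X_def by simp
  qed
  have "\<exists>\<rho>. \<forall>x\<in>fiber k \<inter> miqp_X I E f M. z \<le> q x + \<rho> * ?d x" for k
  proof (cases "\<exists>x\<in>fiber k \<inter> miqp_X I E f M. A *v x = b")
    case True
    then obtain y where y: "y \<in> fiber k" "y \<in> miqp_X I E f M" "A *v y = b" by blast
    have "fiber k \<subseteq> miqp_X I E f M"
      using fiber_sub y by blast
    then have "\<exists>\<rho>\<ge>0. \<forall>x\<in>fiber k. z \<le> q x + \<rho> * ?d x"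
      using int y polyhedron_fiber[of E f I k] unfolding miqp_feasible_def fiber_def[symmetric]
      by (intro polyhedron_exact_penalty[OF q]) auto
    then show ?thesis by blast
  next
    case False
    show ?thesis
    proof (cases "fiber k \<inter> miqp_X I E f M = {}")
      case ne: False
      then have "fiber k \<subseteq> miqp_X I E f M"
        using fiber_sub by blast
      \<comment> \<open>The Farkas certificate: the bound 1 for the zero function holds vacuously
        where \<open>A *v x = b\<close>, since the slice has no such point.\<close>
      then have "\<exists>\<rho>\<ge>0. \<forall>x\<in>fiber k. 1 \<le> 0 + \<rho> * ?d x"
        using False polyhedron_fiber[of E f I k] unfolding fiber_def[symmetric]
        by (intro polyhedron_exact_penalty) (auto simp: convex_on_def)
      then obtain \<rho>1 where \<rho>1: "\<And>x. x \<in> fiber k \<Longrightarrow> 1 \<le> \<rho>1 * ?d x" by auto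
      \<comment> \<open>The \<open>\<rho>0\<close> part secures \<open>z0\<close>; the rest is at
        least \<open>\<bar>z - z0\<bar>\<close> and covers the difference to
        \<open>z\<close>.\<close>
      have "z \<le> q x + (\<rho>0 + \<bar>z - z0\<bar> * \<rho>1) * ?d x" if x: "x \<in> fiber k \<inter> miqp_X I E f M" for x
      proof -
        have "z0 \<le> q x + \<rho>0 * ?d x" using x \<rho>0 by (auto simp: miqp_X_def)
        moreover have "\<bar>z - z0\<bar> * 1 \<le> \<bar>z - z0\<bar> * (\<rho>1 * ?d x)"
          using x \<rho>1 by (intro mult_left_mono) auto
        ultimately show ?thesis by (simp add: algebra_simps)
      qed
      then show ?thesis by blast
    qed auto
  qed
  then obtain r where r: "\<And>k x. x \<in> fiber k \<inter> miqp_X I E f M \<Longrightarrow> z \<le> q x + r k * ?d x"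
    by metis
  \<comment> \<open>The sum dominates every \<open>r k\<close> with \<open>k\<close> in
    \<open>N\<close>, whatever the signs; the summand 1 makes the penalty strictly positive.\<close>
  define \<rho> where "\<rho> = 1 + (\<Sum>k\<in>N. \<bar>r k\<bar>)"
  have N: "finite N" unfolding N_def by (rule finite_integer_parts)
  have "z \<le> q x + \<rho> * ?d x" if x: "x \<in> miqp_X I E f M" for x
  proof -
    define k :: "real ^ 'n" where "k = (\<chi> i. if i \<in> I then x $ i else 0)"
    have "k \<in> N" "x \<in> fiber k"
      using x by (simp_all add: k_def N_def fiber_def miqp_X_def relax_X_def)
    have "r k \<le> \<rho>"
      using member_le_sum[OF \<open>k \<in> N\<close>, of "\<lambda>k. \<bar>r k\<bar>"] N by (simp add: \<rho>_def)
    then have "r k * ?d x \<le> \<rho> * ?d x" by (intro mult_right_mono) auto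
    then show ?thesis using r[of x k] x \<open>x \<in> fiber k\<close> by simp
  qed
  moreover have "\<rho> > 0" unfolding \<rho>_def by (intro add_pos_nonneg sum_nonneg) auto
  ultimately show ?thesis by blast
qed

section \<open>Dual and primal values\<close>

text \<open>Weak duality: at feasible points both the multiplier term and the penalty
  vanish.\<close>

lemma z_LDplus_le_z_IP:
  assumes "\<psi> 0 = 0"
  shows "z_LDplus I A b E f Q c M \<psi> \<rho> \<le> z_IP I A b E f Q c M"
  unfolding z_LDplus_def z_IP_def opt_value_def
proof (intro SUP_least INF_greatest)
  fix l x
  assume x: "x \<in> miqp_feasible I A b E f M"
  have "(INF x\<in>miqp_X I E f M. ereal (miqp_obj I Q c x + l \<bullet> (b - A *v x) + \<rho> * \<psi> (b - A *v x)))
      \<le> ereal (miqp_obj I Q c x + l \<bullet> (b - A *v x) + \<rho> * \<psi> (b - A *v x))"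
    using x by (intro INF_lower) (auto simp: miqp_feasible_def)
  then show "(INF x\<in>miqp_X I E f M. ereal (miqp_obj I Q c x + l \<bullet> (b - A *v x) + \<rho> * \<psi> (b - A *v x)))
      \<le> ereal (miqp_obj I Q c x)"
    using x assms by (simp add: miqp_feasible_def)
qed

text \<open>An attained minimum makes the extended-real infimum finite, so the penalty argument can
  work with real bounds.\<close>

lemma opt_value_lower_bound:
  assumes "has_optimal_solution q S"
  obtains z where "opt_value q S = ereal z" "\<And>x. x \<in> S \<Longrightarrow> z \<le> q x"
proof -
  obtain y where y: "y \<in> S" "\<And>x. x \<in> S \<Longrightarrow> q y \<le> q x"
    using assms by (auto simp: has_optimal_solution_def is_arg_min_linorder)
  then have "opt_value q S = ereal (q y)"
    unfolding opt_value_def by (intro antisym INF_lower2[OF y(1)] INF_greatest) auto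
  then show ?thesis using that y by blast
qed

text \<open>The dependence of the penalty parameter is expressed by quantifying
  \<open>\<rho>\<close> as a function of \<open>A\<close>, \<open>Q\<close>, \<open>c\<close> and
  \<open>M\<close>, while \<open>I\<close>, \<open>b\<close>, \<open>E\<close> and \<open>f\<close>
  are fixed beforehand.\<close>

theorem theorem3p2:
  fixes I :: "'n::finite set"
    and b :: "real ^ 'm::finite"
    and E :: "real ^ 'n ^ 'p::finite"
    and f :: "real ^ 'p"
  assumes "rational_mat E" and "full_rank E"
    and "rational_vec b" and "rational_vec f"
  shows "\<exists>\<rho> :: real ^ 'n ^ 'm \<Rightarrow> real ^ 'n ^ 'n \<Rightarrow> real ^ 'n \<Rightarrow> real \<Rightarrow> real.
    \<forall>A Q c M.
      rational_mat A \<and> full_rank A \<and>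
      rational_mat Q \<and> sym_psd Q \<and> rational_vec c \<and>
      miqp_feasible I A b E f M \<noteq> {} \<and>
      has_optimal_solution (miqp_obj I Q c) (miqp_feasible I A b E f M) \<and>
      relax_feasible I A b E f M \<noteq> {} \<and>
      has_optimal_solution (miqp_obj I Q c) (relax_feasible I A b E f M)
      \<longrightarrow> 0 < \<rho> A Q c M \<and>
          z_LDplus I A b E f Q c M norm (\<rho> A Q c M) = z_IP I A b E f Q c M"
proof -
  have ex: "\<exists>\<rho>>0. z_LDplus I A b E f Q c M norm \<rho> = z_IP I A b E f Q c M"
    if Q: "sym_psd Q" and ip: "has_optimal_solution (miqp_obj I Q c) (miqp_feasible I A b E f M)"
      and ne: "relax_feasible I A b E f M \<noteq> {}"
      and relax: "has_optimal_solution (miqp_obj I Q c) (relax_feasible I A b E f M)"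
    for A :: "real ^ 'n ^ 'm" and Q c M
  proof -
    obtain z where z: "z_IP I A b E f Q c M = ereal z"
      "\<And>x. x \<in> miqp_feasible I A b E f M \<Longrightarrow> z \<le> miqp_obj I Q c x"
      using opt_value_lower_bound[OF ip] unfolding z_IP_def by metis
    obtain z0 where z0: "\<And>x. x \<in> relax_feasible I A b E f M \<Longrightarrow> z0 \<le> miqp_obj I Q c x"
      using opt_value_lower_bound[OF relax] by metis
    obtain \<rho> where "\<rho> > 0" and
      \<rho>: "\<And>x. x \<in> miqp_X I E f M \<Longrightarrow> z \<le> miqp_obj I Q c x + \<rho> * norm (b - A *v x)"
      using miqp_exact_penalty[OF convex_on_miqp_obj[OF Q] z0 ne z(2)] by blast
    have "z_IP I A b E f Q c M \<le> z_LDplus I A b E f Q c M norm \<rho>"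
      unfolding z(1) z_LDplus_def opt_value_def
      using \<rho> by (intro SUP_upper2[of 0] INF_greatest) auto
    then show ?thesis
      using \<open>\<rho> > 0\<close> z_LDplus_le_z_IP[of norm, OF norm_zero] by (intro exI[of _ \<rho>] conjI antisym)
  qed
  \<comment> \<open>Existence for each choice of data becomes a single function by the choice
    operator.\<close>
  then show ?thesis
    by (intro exI[of _ "\<lambda>A Q c M. SOME \<rho>. 0 < \<rho> \<and>
          z_LDplus I A b E f Q c M norm \<rho> = z_IP I A b E f Q c M"] allI impI)
      (elim conjE, rule someI_ex, blast)
qed

end
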